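(* Let $\mathbb{F}$ be a field of characteristic $0$, let $\mathcal{M}$ be the set of all finite-size matrices over $\mathbb{F}$, and let $A\in\mathcal{M}$. Then $(\langle A\rangle,\prec)$ is a lattice.
   Context: $\otimes$ is the Kronecker product. $A\sim B$ means that there exist positive integers $s,t$ with $A\otimes I_s=B\otimes I_t$; this is an equivalence relation on $\mathcal{M}$ and $\langle A\rangle=\{B\in\mathcal{M}: B\sim A\}$. For $B,C\in\langle A\rangle$ write $B\prec C$ if $C=B\otimes I_s$ for some positive integer $s$; this is a partial order on $\langle A\rangle$. A poset $L$ is a lattice if every pair $a,b\in L$ has both a supremum and an infimum in $L$. *)

theory Defs
  imports "HOL-Algebra.Lattice" "Jordan_Normal_Form.Matrix"
begin

definition kronecker :: "'a :: times mat \<Rightarrow> 'a mat \<Rightarrow> 'a mat"  (infixl \<open>\<otimes>\<^sub>K\<close> 70) where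
  "A \<otimes>\<^sub>K B = mat (dim_row A * dim_row B) (dim_col A * dim_col B)
     (\<lambda>(i, j). A $$ (i div dim_row B, j div dim_col B) * B $$ (i mod dim_row B, j mod dim_col B))"

definition mat_equiv :: "'a :: semiring_1 mat \<Rightarrow> 'a mat \<Rightarrow> bool"  (infix \<open>\<sim>\<^sub>M\<close> 50) where
  "A \<sim>\<^sub>M B \<longleftrightarrow> (\<exists>s t. s > 0 \<and> t > 0 \<and> A \<otimes>\<^sub>K 1\<^sub>m s = B \<otimes>\<^sub>K 1\<^sub>m t)"

definition mat_class :: "'a :: semiring_1 mat \<Rightarrow> 'a mat set" where
  "mat_class A = {B. B \<sim>\<^sub>M A}"

definition mat_prec :: "'a :: semiring_1 mat \<Rightarrow> 'a mat \<Rightarrow> bool"  (infix \<open>\<prec>\<^sub>M\<close> 50) where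
  "B \<prec>\<^sub>M C \<longleftrightarrow> (\<exists>s > 0. C = B \<otimes>\<^sub>K 1\<^sub>m s)"

text \<open>Despite the strict-looking symbol, \<open>\<prec>\<^sub>M\<close> is the reflexive order (take \<open>s = 1\<close>).\<close>

definition mat_class_order :: "'a :: semiring_1 mat \<Rightarrow> 'a mat gorder" where
  "mat_class_order A = \<lparr> carrier = mat_class A, eq = (=), le = (\<prec>\<^sub>M) \<rparr>"

text \<open>
  The type \<open>'a mat\<close> contains matrices with zero rows or columns. The following fact shows that
  the class of a matrix with at least one row and one column contains only such matrices, so it is
  the same set whether or not empty matrices are admitted.
\<close>

lemma mat_equiv_empty_iff:
  assumes "A \<sim>\<^sub>M B"
  shows "dim_row A = 0 \<longleftrightarrow> dim_row B = 0" "dim_col A = 0 \<longleftrightarrow> dim_col B = 0"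
proof -
  obtain s t where st: "s > 0" "t > 0" and eq: "A \<otimes>\<^sub>K 1\<^sub>m s = B \<otimes>\<^sub>K 1\<^sub>m t"
    using assms unfolding mat_equiv_def by blast
  have "dim_row A * s = dim_row B * t" "dim_col A * s = dim_col B * t"
    using arg_cong[OF eq, of dim_row] arg_cong[OF eq, of dim_col] by (simp_all add: kronecker_def)
  with st show "dim_row A = 0 \<longleftrightarrow> dim_row B = 0" "dim_col A = 0 \<longleftrightarrow> dim_col B = 0"
    by (metis mult_is_0 not_gr_zero)+
qed

end

theory Submission
  imports Defs "HOL-Number_Theory.Cong"
begin

text \<open>
  If \<open>B \<otimes> I\<^sub>s = C \<otimes> I\<^sub>t\<close>, common factors of \<open>s\<close> and \<open>t\<close> cancel, so
  let \<open>s\<close> and \<open>t\<close> be coprime. The common value \<open>M\<close> vanishes at \<open>(i, j)\<close> unless \<open>i\<close> and \<open>j\<close>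
  are congruent modulo both \<open>s\<close> and \<open>t\<close>, and a diagonal step from \<open>(i, j)\<close> to \<open>(i + 1, j + 1)\<close>
  with \<open>i \<equiv> j\<close> modulo \<open>s t\<close> changes the entry only if both \<open>s\<close> and \<open>t\<close> divide \<open>i + 1\<close>. Hence
  \<open>M = D \<otimes> I\<^sub>s\<^sub>t\<close> for some \<open>D\<close>, and cancellation gives \<open>B = D \<otimes> I\<^sub>t\<close> and
  \<open>C = D \<otimes> I\<^sub>s\<close>. Then \<open>D\<close> is the infimum and \<open>M\<close> the supremum of \<open>B\<close> and \<open>C\<close>.
\<close>

section \<open>Kronecker products with identity matrices\<close>

lemma dim_kronecker [simp]:
  "dim_row (A \<otimes>\<^sub>K B) = dim_row A * dim_row B"
  "dim_col (A \<otimes>\<^sub>K B) = dim_col A * dim_col B"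
  by (simp_all add: kronecker_def)

lemma index_kronecker_one:
  fixes A :: "'a :: semiring_1 mat"
  assumes "i < dim_row A * s" "j < dim_col A * s"
  shows "(A \<otimes>\<^sub>K 1\<^sub>m s) $$ (i, j) = (if i mod s = j mod s then A $$ (i div s, j div s) else 0)"
proof -
  have "s > 0" using assms by (cases s) auto
  with assms show ?thesis by (simp add: kronecker_def)
qed

lemma mult_add_less_mult:
  fixes i k p s :: nat
  assumes "i < p" "k < s"
  shows "i * s + k < p * s"
proof -
  have "i * s + k < Suc i * s" using assms by simp
  also have "\<dots> \<le> p * s" using assms by (intro mult_le_mono1) simp
  finally show ?thesis .
qed

lemma kronecker_one_1 [simp]:
  fixes A :: "'a :: semiring_1 mat"
  shows "A \<otimes>\<^sub>K 1\<^sub>m (Suc 0) = A"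
  by (rule eq_matI) (auto simp: index_kronecker_one)

lemma kronecker_one_assoc:
  fixes A :: "'a :: semiring_1 mat"
  shows "A \<otimes>\<^sub>K 1\<^sub>m s \<otimes>\<^sub>K 1\<^sub>m t = A \<otimes>\<^sub>K 1\<^sub>m (s * t)"
proof (rule eq_matI)
  fix i j
  assume "i < dim_row (A \<otimes>\<^sub>K 1\<^sub>m (s * t))" "j < dim_col (A \<otimes>\<^sub>K 1\<^sub>m (s * t))"
  hence i: "i < dim_row A * s * t" and j: "j < dim_col A * s * t" by (simp_all add: mult.assoc)
  \<comment> \<open>The remainder of an index modulo \<open>s * t\<close> consists of two digits,
    one modulo \<open>t\<close> and one modulo \<open>s\<close>; the nested product tests equality
    of one digit at a time.\<close>
  have mod: "k mod (s * t) = t * (k div t mod s) + k mod t" for k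
    by (metis mod_mult2_eq mult.commute)
  have "t > 0" using i by (cases t) auto
  have eq: "i mod (s * t) = j mod (s * t) \<longleftrightarrow> i mod t = j mod t \<and> i div t mod s = j div t mod s"
  proof
    assume *: "i mod (s * t) = j mod (s * t)"
    hence "i mod t = j mod t" by (metis mod_mult_self4 mod_mod_trivial mod)
    thus "i mod t = j mod t \<and> i div t mod s = j div t mod s"
      using * \<open>t > 0\<close> by (simp add: mod)
  qed (simp add: mod)
  have div: "k div (s * t) = k div t div s" for k
    by (metis div_mult2_eq mult.commute)
  have "i div t < dim_row A * s" "j div t < dim_col A * s"
    using i j by (simp_all add: less_mult_imp_div_less)
  thus "(A \<otimes>\<^sub>K 1\<^sub>m s \<otimes>\<^sub>K 1\<^sub>m t) $$ (i, j) = (A \<otimes>\<^sub>K 1\<^sub>m (s * t)) $$ (i, j)"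
    using i j by (simp add: index_kronecker_one eq div mult.assoc)
qed (simp_all add: mult.assoc)

lemma kronecker_one_commute:
  fixes A :: "'a :: semiring_1 mat"
  shows "A \<otimes>\<^sub>K 1\<^sub>m s \<otimes>\<^sub>K 1\<^sub>m t = A \<otimes>\<^sub>K 1\<^sub>m t \<otimes>\<^sub>K 1\<^sub>m s"
  by (simp add: kronecker_one_assoc mult.commute)

text \<open>Sampling the product at the multiples of \<open>s\<close>, the top left corners of its
  blocks, recovers the first factor.\<close>

lemma kronecker_one_cancel:
  fixes A B :: "'a :: semiring_1 mat"
  assumes eq: "A \<otimes>\<^sub>K 1\<^sub>m s = B \<otimes>\<^sub>K 1\<^sub>m s" and s: "s > 0"
  shows "A = B"
proof (rule eq_matI)
  show row: "dim_row A = dim_row B" and col: "dim_col A = dim_col B"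
    using arg_cong[OF eq, of dim_row] arg_cong[OF eq, of dim_col] s by simp_all
  fix i j assume "i < dim_row B" "j < dim_col B"
  hence "i * s < dim_row B * s" "j * s < dim_col B * s" using s by simp_all
  thus "A $$ (i, j) = B $$ (i, j)"
    using arg_cong[OF eq, of "\<lambda>M. M $$ (i * s, j * s)"] s row col
    by (simp add: index_kronecker_one)
qed

text \<open>One nonzero dimension suffices to read off \<open>s\<close>. The 0 by 0 matrix must be
  excluded, since every product with an identity fixes it; it is treated separately below.\<close>

lemma kronecker_one_inject:
  fixes A :: "'a :: semiring_1 mat"
  assumes "A \<otimes>\<^sub>K 1\<^sub>m s = A \<otimes>\<^sub>K 1\<^sub>m t" "dim_row A \<noteq> 0 \<or> dim_col A \<noteq> 0"
  shows "s = t"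
  using assms(2) arg_cong[OF assms(1), of dim_row] arg_cong[OF assms(1), of dim_col] by auto

lemma kronecker_one_empty:
  fixes A :: "'a :: semiring_1 mat"
  assumes "dim_row A = 0" "dim_col A = 0"
  shows "A \<otimes>\<^sub>K 1\<^sub>m s = A"
  using assms by (intro eq_matI) auto

section \<open>Splitting off a common factor\<close>

text \<open>As \<open>i\<close> and \<open>j\<close> agree modulo \<open>s\<close>, both coordinates
  cross a block border at the same time, and they do so only if \<open>s\<close> divides
  \<open>Suc i\<close>. Otherwise both positions read the same entry of \<open>B\<close>.\<close>

lemma kronecker_one_diagonal_step:
  fixes B :: "'a :: semiring_1 mat"
  assumes "Suc i < dim_row B * s" "Suc j < dim_col B * s"
    and "i mod s = j mod s" "\<not> s dvd Suc i"
  shows "(B \<otimes>\<^sub>K 1\<^sub>m s) $$ (Suc i, Suc j) = (B \<otimes>\<^sub>K 1\<^sub>m s) $$ (i, j)"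
proof -
  have mod: "Suc i mod s = Suc j mod s" using assms(3) by (metis mod_Suc_eq)
  hence "\<not> s dvd Suc j" using assms(4) by (simp add: dvd_eq_mod_eq_0)
  hence "Suc i div s = i div s" "Suc j div s = j div s"
    using assms(4) by (simp_all add: div_Suc dvd_eq_mod_eq_0)
  thus ?thesis using assms mod by (simp add: index_kronecker_one)
qed

lemma kronecker_one_coprime_eqE:
  fixes B C :: "'a :: semiring_1 mat"
  assumes eq: "B \<otimes>\<^sub>K 1\<^sub>m s = C \<otimes>\<^sub>K 1\<^sub>m t" and s: "s > 0" and t: "t > 0" and "coprime s t"
  obtains D where "B = D \<otimes>\<^sub>K 1\<^sub>m t" "C = D \<otimes>\<^sub>K 1\<^sub>m s"
proof -
  define M where "M = B \<otimes>\<^sub>K 1\<^sub>m s"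
  have MC: "M = C \<otimes>\<^sub>K 1\<^sub>m t" using eq by (simp add: M_def)
  have "dim_row B * s = dim_row C * t" "dim_col B * s = dim_col C * t"
    using arg_cong[OF eq, of dim_row] arg_cong[OF eq, of dim_col] by simp_all
  hence "t dvd dim_row B * s" "t dvd dim_col B * s" by simp_all
  \<comment> \<open>Coprimality makes the dimensions of \<open>M\<close> multiples of
    \<open>s * t\<close>, so that \<open>M\<close> splits into \<open>p\<close> by \<open>q\<close>
    square blocks of size \<open>n\<close>.\<close>
  with \<open>coprime s t\<close> have "t dvd dim_row B" "t dvd dim_col B"
    by (simp_all add: coprime_commute coprime_dvd_mult_left_iff)
  then obtain p q where pq: "dim_row B = p * t" "dim_col B = q * t"
    by (metis dvdE mult.commute)
  define n where "n = t * s"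
  have n: "n > 0" using s t by (simp add: n_def)
  have dim: "dim_row M = p * n" "dim_col M = q * n"
    by (simp_all add: M_def pq n_def mult.assoc)
  have dimB: "dim_row B * s = p * n" "dim_col B * s = q * n"
    by (simp_all add: pq n_def mult.assoc)
  have dimC: "dim_row C * t = p * n" "dim_col C * t = q * n"
    using dim by (simp_all add: MC)
  \<comment> \<open>The candidate takes the top left entry of each block of \<open>M\<close>; it
    remains to see that each block is this entry times the identity.\<close>
  define D where "D = mat p q (\<lambda>(a, b). M $$ (a * n, b * n))"
  have diagonal: "M $$ (a * n + k, b * n + k) = M $$ (a * n, b * n)"
    if "k < n" "a < p" "b < q" for a b k
    using that(1)
  proof (induction k)
    case (Suc k)
    have less: "Suc (a * n + k) < p * n" "Suc (b * n + k) < q * n"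
      using mult_add_less_mult[OF that(2) Suc.prems] mult_add_less_mult[OF that(3) Suc.prems]
      by simp_all
    \<comment> \<open>Since \<open>Suc k < n\<close>, the step stays inside the block. So
      \<open>s\<close> or \<open>t\<close> fails to divide \<open>Suc (a * n + k)\<close>, and the
      step is taken in \<open>B \<otimes>\<^sub>K 1\<^sub>m s\<close> or
      \<open>C \<otimes>\<^sub>K 1\<^sub>m t\<close> accordingly.\<close>
    have "\<not> n dvd Suc (a * n + k)"
    proof
      assume "n dvd Suc (a * n + k)"
      hence "n dvd a * n + Suc k" by simp
      hence "n dvd Suc k" by (metis dvd_add_right_iff dvd_triv_right)
      with Suc.prems show False by (meson nat_dvd_not_less zero_less_Suc)
    qed
    moreover have "n dvd Suc (a * n + k)" if "s dvd Suc (a * n + k)" "t dvd Suc (a * n + k)"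
      using divides_mult[OF that(2,1)] \<open>coprime s t\<close> by (simp add: n_def coprime_commute)
    moreover have "(a * n + k) mod s = (b * n + k) mod s" "(a * n + k) mod t = (b * n + k) mod t"
      by (simp_all add: n_def flip: mult.assoc)
        (metis mod_mult_self3 mult.assoc mult.commute)
    ultimately have "M $$ (Suc (a * n + k), Suc (b * n + k)) = M $$ (a * n + k, b * n + k)"
      using kronecker_one_diagonal_step[of "a * n + k" B s "b * n + k"]
        kronecker_one_diagonal_step[of "a * n + k" C t "b * n + k"] less dimB dimC
      by (metis M_def MC)
    thus ?case using Suc by simp
  qed simp
  have "M = D \<otimes>\<^sub>K 1\<^sub>m n"
  proof (rule eq_matI)
    fix i j assume "i < dim_row (D \<otimes>\<^sub>K 1\<^sub>m n)" "j < dim_col (D \<otimes>\<^sub>K 1\<^sub>m n)"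
    hence i: "i < p * n" and j: "j < q * n" by (simp_all add: D_def)
    have div: "i div n < p" "j div n < q" using i j by (simp_all add: less_mult_imp_div_less)
    show "M $$ (i, j) = (D \<otimes>\<^sub>K 1\<^sub>m n) $$ (i, j)"
    proof (cases "i mod n = j mod n")
      case True
      have "M $$ (i, j) = M $$ (i div n * n + i mod n, j div n * n + i mod n)"
        by (metis True div_mult_mod_eq)
      also have "\<dots> = M $$ (i div n * n, j div n * n)"
        using div n by (intro diagonal) simp_all
      finally show ?thesis using i j div True by (simp add: index_kronecker_one D_def)
    next
      case False
      \<comment> \<open>Off the diagonal of a block, the Chinese remainder theorem gives a modulus,
        \<open>s\<close> or \<open>t\<close>, at which \<open>i\<close> and \<open>j\<close> differ,
        and the corresponding form of \<open>M\<close> has a zero there.\<close>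
      hence "\<not> [i = j] (mod s) \<or> \<not> [i = j] (mod t)"
        using coprime_cong_mult_nat[of i j t s] \<open>coprime s t\<close>
        by (auto simp: n_def cong_def coprime_commute)
      hence "M $$ (i, j) = 0"
      proof
        assume "\<not> [i = j] (mod s)"
        thus ?thesis using i j dimB by (simp add: M_def index_kronecker_one cong_def)
      next
        assume "\<not> [i = j] (mod t)"
        thus ?thesis using i j dimC by (simp add: MC index_kronecker_one cong_def)
      qed
      thus ?thesis using i j False by (simp add: index_kronecker_one D_def)
    qed
  qed (simp_all add: D_def dim)
  hence "B \<otimes>\<^sub>K 1\<^sub>m s = D \<otimes>\<^sub>K 1\<^sub>m t \<otimes>\<^sub>K 1\<^sub>m s" "C \<otimes>\<^sub>K 1\<^sub>m t = D \<otimes>\<^sub>K 1\<^sub>m s \<otimes>\<^sub>K 1\<^sub>m t"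
    by (simp_all add: kronecker_one_assoc n_def mult.commute flip: M_def MC)
  thus thesis using that s t by (blast dest: kronecker_one_cancel)
qed

text \<open>The factor \<open>1\<^sub>m g\<close> for the gcd \<open>g\<close> cancels on both
  sides, which reduces to the coprime case.\<close>

lemma mat_equiv_coprimeE:
  fixes B C :: "'a :: semiring_1 mat"
  assumes "B \<sim>\<^sub>M C"
  obtains D s t where "s > 0" "t > 0" "coprime s t" "B = D \<otimes>\<^sub>K 1\<^sub>m t" "C = D \<otimes>\<^sub>K 1\<^sub>m s"
proof -
  obtain s t where st: "s > 0" "t > 0" and eq: "B \<otimes>\<^sub>K 1\<^sub>m s = C \<otimes>\<^sub>K 1\<^sub>m t"
    using assms unfolding mat_equiv_def by blast
  define g where "g = gcd s t"
  obtain s' t' where st': "s = s' * g" "t = t' * g" "coprime s' t'"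
    using gcd_coprime_exists[of s t] st unfolding g_def by auto
  have pos: "s' > 0" "t' > 0" "g > 0" using st st' by auto
  have "B \<otimes>\<^sub>K 1\<^sub>m s' \<otimes>\<^sub>K 1\<^sub>m g = C \<otimes>\<^sub>K 1\<^sub>m t' \<otimes>\<^sub>K 1\<^sub>m g"
    using eq by (simp add: kronecker_one_assoc st'(1,2))
  hence "B \<otimes>\<^sub>K 1\<^sub>m s' = C \<otimes>\<^sub>K 1\<^sub>m t'" using pos by (blast dest: kronecker_one_cancel)
  thus thesis using kronecker_one_coprime_eqE that pos st'(3) by metis
qed

section \<open>The equivalence relation and the partial order\<close>

lemma mat_equiv_sym: "A \<sim>\<^sub>M B \<Longrightarrow> B \<sim>\<^sub>M A"
  unfolding mat_equiv_def by metis

lemma mat_equiv_trans: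
  fixes A B C :: "'a :: semiring_1 mat"
  assumes "A \<sim>\<^sub>M B" "B \<sim>\<^sub>M C"
  shows "A \<sim>\<^sub>M C"
proof -
  obtain s t u v where pos: "s > 0" "t > 0" "u > 0" "v > 0"
    and eq: "A \<otimes>\<^sub>K 1\<^sub>m s = B \<otimes>\<^sub>K 1\<^sub>m t" "B \<otimes>\<^sub>K 1\<^sub>m u = C \<otimes>\<^sub>K 1\<^sub>m v"
    using assms unfolding mat_equiv_def by blast
  have "A \<otimes>\<^sub>K 1\<^sub>m s \<otimes>\<^sub>K 1\<^sub>m u = C \<otimes>\<^sub>K 1\<^sub>m v \<otimes>\<^sub>K 1\<^sub>m t"
    by (simp add: eq kronecker_one_commute[of B t u])
  with pos show ?thesis
    unfolding mat_equiv_def kronecker_one_assoc by (metis nat_0_less_mult_iff)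
qed

lemma mat_equiv_kronecker_one:
  fixes A :: "'a :: semiring_1 mat"
  assumes "s > 0"
  shows "A \<otimes>\<^sub>K 1\<^sub>m s \<sim>\<^sub>M A"
  unfolding mat_equiv_def using assms by (intro exI[of _ "Suc 0"] exI[of _ s]) simp

lemma kronecker_one_mem_mat_class_iff:
  fixes A B :: "'a :: semiring_1 mat"
  assumes "s > 0"
  shows "B \<otimes>\<^sub>K 1\<^sub>m s \<in> mat_class A \<longleftrightarrow> B \<in> mat_class A"
  unfolding mat_class_def using mat_equiv_kronecker_one[OF assms, of B]
  by (auto intro: mat_equiv_sym mat_equiv_trans)

lemma mat_prec_refl: "B \<prec>\<^sub>M B"
  unfolding mat_prec_def by (intro exI[of _ "Suc 0"]) simp

lemma mat_prec_kronecker_one: "s > 0 \<Longrightarrow> B \<prec>\<^sub>M B \<otimes>\<^sub>K 1\<^sub>m s"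
  unfolding mat_prec_def by blast

lemma mat_prec_trans: "B \<prec>\<^sub>M C \<Longrightarrow> C \<prec>\<^sub>M D \<Longrightarrow> B \<prec>\<^sub>M D"
  unfolding mat_prec_def by (metis kronecker_one_assoc nat_0_less_mult_iff)

lemma mat_prec_antisym:
  fixes B C :: "'a :: semiring_1 mat"
  assumes "B \<prec>\<^sub>M C" "C \<prec>\<^sub>M B"
  shows "B = C"
proof -
  obtain s t where C: "C = B \<otimes>\<^sub>K 1\<^sub>m s" and B: "B = C \<otimes>\<^sub>K 1\<^sub>m t"
    using assms unfolding mat_prec_def by blast
  \<comment> \<open>Going from \<open>B\<close> to \<open>C\<close> and back multiplies by
    \<open>1\<^sub>m (s * t)\<close>; comparing dimensions forces \<open>s * t\<close> to be 1
    unless \<open>B\<close> is 0 by 0.\<close>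
  have eq: "B \<otimes>\<^sub>K 1\<^sub>m (s * t) = B \<otimes>\<^sub>K 1\<^sub>m (Suc 0)"
    using B C by (simp flip: kronecker_one_assoc)
  show ?thesis
  proof (cases "dim_row B = 0 \<and> dim_col B = 0")
    case True
    thus ?thesis by (simp add: C kronecker_one_empty)
  next
    case False
    hence "s * t = Suc 0" using kronecker_one_inject[OF eq] by auto
    thus ?thesis by (simp add: C)
  qed
qed

lemma partial_order_mat_class_order: "partial_order (mat_class_order A)"
  by unfold_locales
    (auto simp: mat_class_order_def intro: mat_prec_refl mat_prec_antisym mat_prec_trans)

section \<open>Suprema and infima\<close>

text \<open>This is the least common multiple property: \<open>t * a = s * b\<close> with
  \<open>s\<close> and \<open>t\<close> coprime forces \<open>s\<close> to divide
  \<open>a\<close>.\<close>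

lemma mat_prec_sup:
  fixes D E :: "'a :: semiring_1 mat"
  assumes "coprime s t" "s > 0" and "D \<otimes>\<^sub>K 1\<^sub>m t \<prec>\<^sub>M E" "D \<otimes>\<^sub>K 1\<^sub>m s \<prec>\<^sub>M E"
  shows "D \<otimes>\<^sub>K 1\<^sub>m (t * s) \<prec>\<^sub>M E"
proof -
  obtain a b where ab: "a > 0" "E = D \<otimes>\<^sub>K 1\<^sub>m (t * a)" "E = D \<otimes>\<^sub>K 1\<^sub>m (s * b)"
    using assms(3,4) unfolding mat_prec_def kronecker_one_assoc by blast
  show ?thesis
  proof (cases "dim_row D = 0 \<and> dim_col D = 0")
    case True
    thus ?thesis by (simp add: ab(2) kronecker_one_empty mat_prec_refl)
  next
    case False
    have "t * a = s * b" using kronecker_one_inject[of D "t * a" "s * b"] ab False by metis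
    hence "s dvd a" using assms(1) by (metis coprime_dvd_mult_right_iff dvd_triv_left)
    then obtain k where "a = s * k" ..
    with ab show ?thesis
      unfolding mat_prec_def kronecker_one_assoc by (intro exI[of _ k]) (simp add: mult.assoc)
  qed
qed

text \<open>Dually to the supremum, \<open>a * s = b * t\<close> forces \<open>t\<close> to divide
  \<open>a\<close>, and cancelling \<open>1\<^sub>m t\<close> leaves \<open>D\<close> as a multiple
  of \<open>E\<close>.\<close>

lemma mat_prec_inf:
  fixes D E :: "'a :: semiring_1 mat"
  assumes "coprime s t" "t > 0" and "E \<prec>\<^sub>M D \<otimes>\<^sub>K 1\<^sub>m t" "E \<prec>\<^sub>M D \<otimes>\<^sub>K 1\<^sub>m s"
  shows "E \<prec>\<^sub>M D"
proof -
  obtain a b where ab: "a > 0" "D \<otimes>\<^sub>K 1\<^sub>m t = E \<otimes>\<^sub>K 1\<^sub>m a" "D \<otimes>\<^sub>K 1\<^sub>m s = E \<otimes>\<^sub>K 1\<^sub>m b"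
    using assms(3,4) unfolding mat_prec_def by blast
  have "\<exists>k > 0. E \<otimes>\<^sub>K 1\<^sub>m a = E \<otimes>\<^sub>K 1\<^sub>m (k * t)"
  proof (cases "dim_row E = 0 \<and> dim_col E = 0")
    case True
    thus ?thesis by (auto simp: kronecker_one_empty)
  next
    case False
    \<comment> \<open>Both sides equal \<open>D \<otimes>\<^sub>K 1\<^sub>m (t * s)\<close>.\<close>
    have "E \<otimes>\<^sub>K 1\<^sub>m (a * s) = E \<otimes>\<^sub>K 1\<^sub>m (b * t)"
      using kronecker_one_commute[of D t s] ab by (simp add: kronecker_one_assoc)
    hence "a * s = b * t" using kronecker_one_inject False by blast
    hence "t dvd a" using assms(1)
      by (metis coprime_commute coprime_dvd_mult_left_iff dvd_triv_right)
    then obtain k where "a = t * k" ..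
    with ab(1) show ?thesis by (intro exI[of _ k]) (simp add: mult.commute)
  qed
  then obtain k where k: "k > 0" "D \<otimes>\<^sub>K 1\<^sub>m t = E \<otimes>\<^sub>K 1\<^sub>m k \<otimes>\<^sub>K 1\<^sub>m t"
    by (auto simp: ab(2) kronecker_one_assoc)
  hence "D = E \<otimes>\<^sub>K 1\<^sub>m k" using assms(2) kronecker_one_cancel by blast
  with k show ?thesis by (simp add: mat_prec_kronecker_one)
qed

theorem theorem25:
  fixes A :: "'a :: field_char_0 mat"
  shows "lattice (mat_class_order A)"
proof -
  interpret partial_order "mat_class_order A" by (rule partial_order_mat_class_order)
  have "(\<exists>S. least (mat_class_order A) S (Upper (mat_class_order A) {B, C})) \<and>
        (\<exists>I. greatest (mat_class_order A) I (Lower (mat_class_order A) {B, C}))"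
    if B: "B \<in> mat_class A" and C: "C \<in> mat_class A" for B C
  proof -
    have "B \<sim>\<^sub>M C"
      using B C by (auto simp: mat_class_def intro: mat_equiv_sym mat_equiv_trans)
    then obtain D s t where st: "s > 0" "t > 0" "coprime s t"
      and eq: "B = D \<otimes>\<^sub>K 1\<^sub>m t" "C = D \<otimes>\<^sub>K 1\<^sub>m s"
      by (rule mat_equiv_coprimeE)
    \<comment> \<open>The bounds must lie in the class itself; they do, because \<open>B\<close> is
      a multiple of \<open>D\<close>.\<close>
    have D: "D \<in> mat_class A" "D \<otimes>\<^sub>K 1\<^sub>m (t * s) \<in> mat_class A"
      using B st eq by (simp_all add: kronecker_one_mem_mat_class_iff)
    have "B \<prec>\<^sub>M D \<otimes>\<^sub>K 1\<^sub>m (t * s)" "C \<prec>\<^sub>M D \<otimes>\<^sub>K 1\<^sub>m (t * s)"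
      using mat_prec_kronecker_one[of s B] mat_prec_kronecker_one[of t C] st
      by (simp_all add: eq kronecker_one_assoc mult.commute)
    hence "least (mat_class_order A) (D \<otimes>\<^sub>K 1\<^sub>m (t * s)) (Upper (mat_class_order A) {B, C})"
      using D B C mat_prec_sup[OF st(3,1)]
      by (auto simp: least_def Upper_def mat_class_order_def eq)
    moreover have "D \<prec>\<^sub>M B" "D \<prec>\<^sub>M C" using st by (simp_all add: eq mat_prec_kronecker_one)
    hence "greatest (mat_class_order A) D (Lower (mat_class_order A) {B, C})"
      using D B C mat_prec_inf[OF st(3,2)]
      by (auto simp: greatest_def Lower_def mat_class_order_def eq)
    ultimately show ?thesis by blast
  qed
  thus ?thesis
    by unfold_locales (simp_all add: mat_class_order_def)
qed

end
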